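(* For every integer $k\geq 1$, the signed Roman domination numbers of the graphs $R_n$ satisfy: $\gamma_{sR}(R_{3k})=2k$; $2k+1\leq\gamma_{sR}(R_{3k+1})\leq 2k+2$; and $\gamma_{sR}(R_{3k+2})=2k+2$.
   Context: Graphs are finite, undirected and simple. For a vertex $v$ of a graph $G=(V,E)$, $N(v)=\{u\in V\mid uv\in E\}$ and $N[v]=N(v)\cup\{v\}$. A signed Roman domination (SRD) function on $G$ is a function $f:V\to\{-1,1,2\}$ such that (i) $\sum_{u\in N[v]}f(u)\geq 1$ for every $v\in V$, and (ii) every $v\in V$ with $f(v)=-1$ has a neighbor $u\in N(v)$ with $f(u)=2$. The weight of $f$ is $f(V)=\sum_{v\in V}f(v)$, and the signed Roman domination number $\gamma_{sR}(G)$ is the minimum weight of an SRD function on $G$. For $n\geq 3$, the graph $R_n$ has $3n$ distinct vertices $V(R_n)=\{a_i,b_i,c_i\mid i=0,\ldots,n-1\}$ and edge set $E(R_n)=\{a_ia_{i+1},\,b_ib_{i+1},\,c_ic_{i+1},\,a_ib_i,\,b_ic_i,\,a_{i+1}b_i\mid i=0,\ldots,n-1\}$, with vertex indices taken modulo $n$. *)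

theory Defs
  imports "Graph_Theory.Pair_Digraph"
begin

text \<open>
  Finite simple undirected graphs are elements of the locale \<^locale>\<open>pair_graph\<close>: an
  undirected edge \<open>uv\<close> is represented by the two arcs \<open>(u, v)\<close> and \<open>(v, u)\<close>.
\<close>

definition open_nbhd :: "'a pair_pre_digraph \<Rightarrow> 'a \<Rightarrow> 'a set" where
  "open_nbhd G v = {u \<in> pverts G. (u, v) \<in> parcs G}"

definition closed_nbhd :: "'a pair_pre_digraph \<Rightarrow> 'a \<Rightarrow> 'a set" where
  "closed_nbhd G v = open_nbhd G v \<union> {v}"

text \<open>Only the values of \<open>f\<close> on the vertex set matter.\<close>

definition SRD_function :: "'a pair_pre_digraph \<Rightarrow> ('a \<Rightarrow> int) \<Rightarrow> bool" where
  "SRD_function G f \<longleftrightarrow>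
     (\<forall>v \<in> pverts G. f v \<in> {-1, 1, 2}) \<and>
     (\<forall>v \<in> pverts G. (\<Sum>u \<in> closed_nbhd G v. f u) \<ge> 1) \<and>
     (\<forall>v \<in> pverts G. f v = -1 \<longrightarrow> (\<exists>u \<in> open_nbhd G v. f u = 2))"

definition SRD_weight :: "'a pair_pre_digraph \<Rightarrow> ('a \<Rightarrow> int) \<Rightarrow> int" where
  "SRD_weight G f = (\<Sum>v \<in> pverts G. f v)"

definition SRD_number :: "'a pair_pre_digraph \<Rightarrow> int" where
  "SRD_number G = Min {SRD_weight G f | f. SRD_function G f}"

text \<open>The minimum in \<^const>\<open>SRD_number\<close> is taken over a finite nonempty set.\<close>

lemma finite_SRD_weights:
  assumes "finite (pverts G)"
  shows "finite {SRD_weight G f | f. SRD_function G f}"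
proof (rule finite_subset)
  show "{SRD_weight G f | f. SRD_function G f} \<subseteq>
          {- int (card (pverts G)) .. 2 * int (card (pverts G))}"
  proof clarify
    fix f assume "SRD_function G f"
    then have bd: "-1 \<le> f v \<and> f v \<le> 2" if "v \<in> pverts G" for v
      using that unfolding SRD_function_def by fastforce
    have "(\<Sum>v \<in> pverts G. -1) \<le> SRD_weight G f"
      unfolding SRD_weight_def by (rule sum_mono) (use bd in auto)
    moreover have "SRD_weight G f \<le> (\<Sum>v \<in> pverts G. 2)"
      unfolding SRD_weight_def by (rule sum_mono) (use bd in auto)
    ultimately show "SRD_weight G f \<in> {- int (card (pverts G)) .. 2 * int (card (pverts G))}"
      by simp
  qed
qed simp

lemma SRD_function_one:
  assumes "finite (pverts G)"
  shows "SRD_function G (\<lambda>_. 1)"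
proof -
  have "finite (closed_nbhd G v)" for v
    using assms by (simp add: closed_nbhd_def open_nbhd_def)
  then have "card (closed_nbhd G v) \<ge> 1" for v
    by (metis One_nat_def Suc_leI UnI2 card_gt_0_iff closed_nbhd_def emptyE singletonI)
  then show ?thesis
    by (simp add: SRD_function_def)
qed

lemma SRD_number_attained:
  assumes "finite (pverts G)"
  obtains f where "SRD_function G f" "SRD_weight G f = SRD_number G"
proof -
  have "SRD_number G \<in> {SRD_weight G f | f. SRD_function G f}"
    unfolding SRD_number_def
    by (rule Min_in) (use finite_SRD_weights SRD_function_one assms in auto)
  with that show thesis by auto
qed

lemma SRD_number_le:
  assumes "finite (pverts G)" "SRD_function G f"
  shows "SRD_number G \<le> SRD_weight G f"
  unfolding SRD_number_def
  by (rule Min_le) (use finite_SRD_weights assms in auto)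


datatype R_vertex = va nat | vb nat | vc nat

definition R_vertices :: "nat \<Rightarrow> R_vertex set" where
  "R_vertices n = (\<Union>i<n. {va i, vb i, vc i})"

text \<open>Each edge is listed here in one orientation only; \<open>R_graph\<close> adds the reverse arcs.\<close>

definition R_edges :: "nat \<Rightarrow> R_vertex rel" where
  "R_edges n = (\<Union>i<n. let i' = (i + 1) mod n in
     {(va i, va i'), (vb i, vb i'), (vc i, vc i'), (va i, vb i), (vb i, vc i), (va i', vb i)})"

definition R_graph :: "nat \<Rightarrow> R_vertex pair_pre_digraph" where
  "R_graph n = \<lparr> pverts = R_vertices n, parcs = R_edges n \<union> (R_edges n)\<inverse> \<rparr>"

lemma pair_graph_R_graph:
  assumes "n \<ge> 3"
  shows "pair_graph (R_graph n)"
proof -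
  have lt: "Suc i mod n < n" for i
    using assms by simp
  have ne: "Suc i mod n \<noteq> i" if "i < n" for i
    using assms that by (auto simp: mod_Suc)
  have sub: "R_edges n \<subseteq> R_vertices n \<times> R_vertices n"
    by (auto simp: R_edges_def R_vertices_def Let_def lt)
  have fin: "finite (R_vertices n)"
    by (simp add: R_vertices_def)
  have irr: "(v, v) \<notin> R_edges n" for v
    using ne by (fastforce simp: R_edges_def Let_def)
  have sym: "sym (R_edges n \<union> (R_edges n)\<inverse>)"
    by (simp add: sym_Un_converse)
  have "finite (R_edges n)"
    using sub fin by (meson finite_SigmaI finite_subset)
  then show ?thesis
    using sub fin irr sym
    by unfold_locales (auto simp: R_graph_def symmetric_def)
qed

lemma card_R_vertices: "card (pverts (R_graph n)) = 3 * n"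
proof -
  have "pverts (R_graph n) = va ` {..<n} \<union> vb ` {..<n} \<union> vc ` {..<n}"
    by (auto simp: R_graph_def R_vertices_def)
  moreover have "card (va ` {..<n} \<union> vb ` {..<n} \<union> vc ` {..<n}) = 3 * n"
    by (subst card_Un_disjoint; (subst card_Un_disjoint)?)
      (auto simp: card_image inj_on_def)
  ultimately show ?thesis
    by simp
qed

end

theory Submission
  imports Defs
begin

text \<open>
  Summing the condition \<open>f(N[v]) \<ge> 1\<close> over the vertices \<open>a\<^sub>i\<close> and \<open>c\<^sub>i\<close> only counts every vertex
  exactly three times, hence three times the weight is at least \<open>2n\<close>. Conversely, put \<open>-1\<close> on
  all \<open>a\<^sub>i\<close>, \<open>2\<close> on all \<open>b\<^sub>i\<close>, and on \<open>c\<^sub>i\<close> put \<open>1\<close> if \<open>3\<close> divides \<open>i\<close> and \<open>-1\<close> otherwise; since any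
  three cyclically consecutive indices contain a multiple of \<open>3\<close>, this is an SRD function, of
  weight \<open>2\<lceil>n/3\<rceil>\<close>.
\<close>

definition csucc :: "nat \<Rightarrow> nat \<Rightarrow> nat" where
  "csucc n i = Suc i mod n"

text \<open>The case split handles wrap-around: subtraction on \<open>nat\<close> truncates, so
  \<open>(i - 1) mod n\<close> would send \<open>0\<close> to \<open>0\<close>.\<close>

definition cpred :: "nat \<Rightarrow> nat \<Rightarrow> nat" where
  "cpred n i = (if i = 0 then n - 1 else i - 1)"

lemma csucc_eq: "i < n \<Longrightarrow> csucc n i = (if Suc i = n then 0 else Suc i)"
  by (simp add: csucc_def)

lemma csucc_less: "i < n \<Longrightarrow> csucc n i < n"
  by (simp add: csucc_def)

lemma cpred_less: "i < n \<Longrightarrow> cpred n i < n"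
  by (auto simp: cpred_def)

lemma csucc_cpred: "i < n \<Longrightarrow> csucc n (cpred n i) = i"
  by (auto simp: csucc_eq cpred_def)

lemma cpred_csucc: "i < n \<Longrightarrow> cpred n (csucc n i) = i"
  by (auto simp: csucc_eq cpred_def)

text \<open>For \<open>n \<ge> 3\<close> the listed neighbors are pairwise distinct, so a sum over a
  closed neighborhood has one summand per listed vertex.\<close>

lemma cyclic_indices_distinct:
  assumes "n \<ge> 3" "i < n"
  shows "csucc n i \<noteq> i" "cpred n i \<noteq> i" "cpred n i \<noteq> csucc n i"
  using assms by (auto simp: csucc_eq cpred_def)

lemma bij_betw_csucc: "bij_betw (csucc n) {..<n} {..<n}"
  by (rule bij_betw_byWitness[where f' = "cpred n"])
    (auto simp: csucc_less cpred_less csucc_cpred cpred_csucc)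

lemma bij_betw_cpred: "bij_betw (cpred n) {..<n} {..<n}"
  by (rule bij_betw_byWitness[where f' = "csucc n"])
    (auto simp: csucc_less cpred_less csucc_cpred cpred_csucc)

lemma pverts_R_graph: "pverts (R_graph n) = (\<Union>i<n. {va i, vb i, vc i})"
  by (simp add: R_graph_def R_vertices_def)

lemma finite_R_graph: "finite (pverts (R_graph n))"
  by (simp add: pverts_R_graph)

lemma R_edges_csucc:
  "R_edges n = (\<Union>i<n. {(va i, va (csucc n i)), (vb i, vb (csucc n i)), (vc i, vc (csucc n i)),
     (va i, vb i), (vb i, vc i), (va (csucc n i), vb i)})"
  by (simp add: R_edges_def csucc_def Let_def)

lemma open_nbhd_R_graph:
  assumes "i < n"
  shows "open_nbhd (R_graph n) (va i) = {va (csucc n i), va (cpred n i), vb i, vb (cpred n i)}"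
    and "open_nbhd (R_graph n) (vb i) =
           {vb (csucc n i), vb (cpred n i), va i, va (csucc n i), vc i}"
    and "open_nbhd (R_graph n) (vc i) = {vc (csucc n i), vc (cpred n i), vb i}"
  using assms
  \<comment> \<open>Arcs stored under index \<open>j\<close> and ending at index
    \<open>csucc n j = i\<close> are found with the witness \<open>j = cpred n i\<close>.\<close>
  by (auto simp: open_nbhd_def R_graph_def R_vertices_def R_edges_csucc csucc_less cpred_less
      csucc_cpred cpred_csucc intro: bexI[of _ "cpred n i"])

lemma sum_closed_nbhd_R_graph:
  assumes "n \<ge> 3" "i < n"
  shows "sum f (closed_nbhd (R_graph n) (va i)) =
           f (va i) + f (va (csucc n i)) + f (va (cpred n i)) + f (vb i) + f (vb (cpred n i))"
    and "sum f (closed_nbhd (R_graph n) (vb i)) =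
           f (vb i) + f (vb (csucc n i)) + f (vb (cpred n i)) + f (va i) + f (va (csucc n i))
           + f (vc i)"
    and "sum f (closed_nbhd (R_graph n) (vc i)) =
           f (vc i) + f (vc (csucc n i)) + f (vc (cpred n i)) + f (vb i)"
  using cyclic_indices_distinct[OF assms] cyclic_indices_distinct[OF assms, symmetric]
  by (simp_all add: closed_nbhd_def open_nbhd_R_graph[OF assms(2)] add_ac)

lemma SRD_weight_R_graph:
  "SRD_weight (R_graph n) f = (\<Sum>i<n. f (va i)) + (\<Sum>i<n. f (vb i)) + (\<Sum>i<n. f (vc i))"
proof -
  have "SRD_weight (R_graph n) f = (\<Sum>i<n. sum f {va i, vb i, vc i})"
    unfolding SRD_weight_def pverts_R_graph by (subst sum.UNION_disjoint) auto
  then show ?thesis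
    by (simp add: sum.distrib add.assoc)
qed

lemma SRD_weight_R_graph_lower:
  assumes n: "n \<ge> 3" and f: "SRD_function (R_graph n) f"
  shows "2 * int n \<le> 3 * SRD_weight (R_graph n) f"
proof -
  have nbhd: "1 \<le> sum f (closed_nbhd (R_graph n) v)" if "v \<in> pverts (R_graph n)" for v
    using f that by (simp add: SRD_function_def)
  have "2 * int n = (\<Sum>i<n. 2)"
    by simp
  also have "\<dots> \<le> (\<Sum>i<n. sum f (closed_nbhd (R_graph n) (va i))
                       + sum f (closed_nbhd (R_graph n) (vc i)))"
  proof (rule sum_mono)
    fix i assume "i \<in> {..<n}"
    then have "va i \<in> pverts (R_graph n)" "vc i \<in> pverts (R_graph n)"
      by (auto simp: pverts_R_graph)
    from nbhd[OF this(1)] nbhd[OF this(2)]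
    show "2 \<le> sum f (closed_nbhd (R_graph n) (va i)) + sum f (closed_nbhd (R_graph n) (vc i))"
      by simp
  qed
  also have "\<dots> = (\<Sum>i<n. f (va i) + f (va (csucc n i)) + f (va (cpred n i))
      + f (vb i) + f (vb (cpred n i)) + f (vc i) + f (vc (csucc n i)) + f (vc (cpred n i))
      + f (vb i))"
    by (rule sum.cong) (simp_all add: sum_closed_nbhd_R_graph n)
  \<comment> \<open>Rotating indices preserves cyclic sums. The \<open>a\<close>-neighborhoods count
    each \<open>va j\<close> three times and each \<open>vb j\<close> twice; the
    \<open>c\<close>-neighborhoods count each \<open>vc j\<close> three times and supply the third
    \<open>vb j\<close>.\<close>
  also have "\<dots> = 3 * SRD_weight (R_graph n) f"
  proof -
    have shift: "(\<Sum>i<n. g (csucc n i)) = (\<Sum>i<n. g i)" "(\<Sum>i<n. g (cpred n i)) = (\<Sum>i<n. g i)"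
      for g :: "nat \<Rightarrow> int"
      by (rule sum.reindex_bij_betw[OF bij_betw_csucc] sum.reindex_bij_betw[OF bij_betw_cpred])+
    show ?thesis
      by (simp add: SRD_weight_R_graph sum.distrib flip: sum_distrib_left add: shift[of "\<lambda>i. f (va i)"]
          shift[of "\<lambda>i. f (vb i)"] shift[of "\<lambda>i. f (vc i)"])
  qed
  finally show ?thesis .
qed

fun optimal_SRD :: "R_vertex \<Rightarrow> int" where
  "optimal_SRD (va i) = -1"
| "optimal_SRD (vb i) = 2"
| "optimal_SRD (vc i) = (if 3 dvd i then 1 else -1)"

text \<open>Without wrap-around these are three consecutive integers; with it, the window contains
  \<open>0\<close>.\<close>

lemma three_dvd_cyclic_window:
  assumes "i < n"
  shows "3 dvd cpred n i \<or> 3 dvd i \<or> 3 dvd csucc n i"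
  using assms unfolding csucc_eq[OF assms] cpred_def by (cases "i = 0"; presburger)

text \<open>The neighborhood sum is \<open>-3 + 4 = 1\<close> at \<open>va i\<close>, at least
  \<open>6 - 2 - 1 = 3\<close> at \<open>vb i\<close>, and at least \<open>2 + 1 - 2 = 1\<close> at
  \<open>vc i\<close>. Every vertex of value \<open>-1\<close> is adjacent to \<open>vb i\<close> of
  its own index.\<close>

lemma SRD_function_optimal_SRD:
  assumes "n \<ge> 3"
  shows "SRD_function (R_graph n) optimal_SRD"
proof -
  have "1 \<le> sum optimal_SRD (closed_nbhd (R_graph n) v)" if "v \<in> pverts (R_graph n)" for v
    using that assms
    by (auto simp: pverts_R_graph sum_closed_nbhd_R_graph dest: three_dvd_cyclic_window)
  moreover have "\<exists>u \<in> open_nbhd (R_graph n) v. optimal_SRD u = 2"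
    if "v \<in> pverts (R_graph n)" "optimal_SRD v = -1" for v
    using that by (auto simp: pverts_R_graph open_nbhd_R_graph)
  moreover have "optimal_SRD v \<in> {-1, 1, 2}" for v
    by (cases v) auto
  ultimately show ?thesis
    by (simp add: SRD_function_def)
qed

lemma SRD_weight_optimal_SRD:
  "SRD_weight (R_graph n) optimal_SRD = 2 * int ((n + 2) div 3)"
proof -
  have "(\<Sum>i<n. if 3 dvd i then 1 else -1 :: int) = 2 * int ((n + 2) div 3) - int n"
  proof (induction n)
    case (Suc n)
    \<comment> \<open>\<open>(n + 2) div 3\<close> counts the multiples of \<open>3\<close> below
      \<open>n\<close>, so it grows exactly when the new index \<open>n\<close> is one.\<close>
    have "(Suc n + 2) div 3 = (if 3 dvd n then Suc ((n + 2) div 3) else (n + 2) div 3)"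
      by presburger
    with Suc show ?case
      by simp
  qed simp
  then show ?thesis
    by (simp add: SRD_weight_R_graph)
qed

lemma SRD_number_R_graph_bounds:
  assumes "n \<ge> 3"
  shows "2 * int n \<le> 3 * SRD_number (R_graph n)"
    and "SRD_number (R_graph n) \<le> 2 * int ((n + 2) div 3)"
proof -
  show "2 * int n \<le> 3 * SRD_number (R_graph n)"
    using SRD_number_attained[OF finite_R_graph] SRD_weight_R_graph_lower[OF assms] by metis
  show "SRD_number (R_graph n) \<le> 2 * int ((n + 2) div 3)"
    using SRD_number_le[OF finite_R_graph SRD_function_optimal_SRD[OF assms]]
    by (simp add: SRD_weight_optimal_SRD)
qed

theorem theorem2:
  fixes k :: nat
  assumes "k \<ge> 1"
  shows "SRD_number (R_graph (3 * k)) = 2 * int k \<and>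
         2 * int k + 1 \<le> SRD_number (R_graph (3 * k + 1)) \<and>
         SRD_number (R_graph (3 * k + 1)) \<le> 2 * int k + 2 \<and>
         SRD_number (R_graph (3 * k + 2)) = 2 * int k + 2"
proof -
  have "(3 * k + 2) div 3 = k" "(3 * k + 1 + 2) div 3 = k + 1" "(3 * k + 2 + 2) div 3 = k + 1"
    by simp_all
  \<comment> \<open>Integrality rounds the lower bounds up: \<open>3 * x \<ge> 6 * k + 2\<close>
    gives \<open>x \<ge> 2 * k + 1\<close>, and \<open>3 * x \<ge> 6 * k + 4\<close> gives
    \<open>x \<ge> 2 * k + 2\<close>.\<close>
  then show ?thesis
    using assms SRD_number_R_graph_bounds[of "3 * k"] SRD_number_R_graph_bounds[of "3 * k + 1"]
      SRD_number_R_graph_bounds[of "3 * k + 2"]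
    by simp
qed

end
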